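(* For a Zinbiel algebra $A$ let $CD(A)$ denote the space of its central derivations. \begin{enumerate} \item If $A$ is a two-dimensional Zinbiel algebra over $\mathbb{C}$, then $\dim CD(A)=1$. \item If $A$ is a three-dimensional Zinbiel algebra over $\mathbb{C}$, then $0\le\dim CD(A)\le 9$. \item If $A$ is a four-dimensional Zinbiel algebra over $\mathbb{C}$, then $0\le\dim CD(A)\le 9$. \end{enumerate}
   Context: A Zinbiel algebra over a field $\mathbb{K}$ is a $\mathbb{K}$-vector space $A$ with a bilinear product $\bullet$ satisfying $(a\bullet b)\bullet c = a\bullet(b\bullet c)+a\bullet(c\bullet b)$ for all $a,b,c\in A$. The center of $A$ is $C(A)=\{a\in A : a\bullet x = x\bullet a=0\ \text{for all } x\in A\}$. A linear map $\phi:A\to A$ is a central derivation if $\phi(A)\subseteq C(A)$ and $\phi(A\bullet A)=0$, where $A\bullet A$ is the span of all products. $CD(A)$ is the vector space of all central derivations of $A$.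
   Formalization: Items 1 and 3 are stated for algebras whose product is not identically zero; for the zero product CD(A) is the space of all linear endomorphisms, of dimension 4 in dimension two and 16 in dimension four, so these items fail there. *)

theory Defs
  imports Complex_Main "HOL-Library.Function_Algebras"
begin

locale zinbiel_algebra = vector_space scale
  for scale :: "'k::field \<Rightarrow> 'a::ab_group_add \<Rightarrow> 'a" +
  fixes zmult :: "'a \<Rightarrow> 'a \<Rightarrow> 'a"  (infixl "\<bullet>" 70)
  assumes linear_right: "\<And>a. Vector_Spaces.linear scale scale (\<lambda>b. a \<bullet> b)"
    and linear_left: "\<And>b. Vector_Spaces.linear scale scale (\<lambda>a. a \<bullet> b)"
    and zinbiel: "\<And>a b c. (a \<bullet> b) \<bullet> c = a \<bullet> (b \<bullet> c) + a \<bullet> (c \<bullet> b)"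
begin

definition center :: "'a set" where
  "center = {a. \<forall>x. a \<bullet> x = 0 \<and> x \<bullet> a = 0}"

definition square :: "'a set" where
  "square = span {a \<bullet> b | a b. True}"

definition central_derivations :: "('a \<Rightarrow> 'a) set" where
  "central_derivations =
     {\<phi>. Vector_Spaces.linear scale scale \<phi> \<and> range \<phi> \<subseteq> center \<and> \<phi> ` square \<subseteq> {0}}"

text \<open>Together with the pointwise addition from \<^theory>\<open>HOL-Library.Function_Algebras\<close>,
  this makes the maps from the algebra to itself a vector space.\<close>

definition fun_scale :: "'k \<Rightarrow> ('a \<Rightarrow> 'a) \<Rightarrow> 'a \<Rightarrow> 'a" where
  "fun_scale c \<phi> = (\<lambda>x. scale c (\<phi> x))"

sublocale maps: vector_space fun_scale
  by unfold_locales
    (simp_all add: fun_scale_def fun_eq_iff scale_right_distrib scale_left_distrib)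

definition dim_CD :: nat where
  "dim_CD = maps.dim central_derivations"

lemma subspace_central_derivations: "maps.subspace central_derivations"
proof -
  have add: "a \<bullet> (x + y) = a \<bullet> x + a \<bullet> y" "(x + y) \<bullet> a = x \<bullet> a + y \<bullet> a" for a x y
    using linear_right[of a] linear_left[of a]
    by (auto dest: module_hom.add simp: linear_iff_module_hom)
  have scl: "a \<bullet> scale r x = scale r (a \<bullet> x)" "scale r x \<bullet> a = scale r (x \<bullet> a)" for a r x
    using linear_right[of a] linear_left[of a]
    by (auto dest: module_hom.scale simp: linear_iff_module_hom)
  have z: "a \<bullet> 0 = 0" "0 \<bullet> a = 0" for a
    using add(1)[of a 0 0] add(2)[of 0 0 a] by simp_all
  interpret P: vector_space_pair scale scale by unfold_locales
  show ?thesis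
    unfolding maps.subspace_def central_derivations_def center_def
    by (auto simp: fun_scale_def zero_fun_def plus_fun_def z add scl image_subset_iff
        intro!: P.linear_zero P.linear_compose_add P.linear_compose_scale_right)
qed

text \<open>For the zero product every linear endomorphism is a central derivation, so the space of
  central derivations of an $n$-dimensional zero algebra has dimension $n^2$.\<close>

lemma central_derivations_zero_product:
  assumes "\<And>a b. a \<bullet> b = 0"
  shows "central_derivations = {\<phi>. Vector_Spaces.linear scale scale \<phi>}"
proof -
  have "square = {0}"
    unfolding square_def using assms by (auto simp: span_singleton)
  moreover have "\<phi> 0 = 0" if "Vector_Spaces.linear scale scale \<phi>" for \<phi>
    using that by (simp add: linear_iff_module_hom module_hom.zero)
  ultimately show ?thesis
    unfolding central_derivations_def center_def using assms by auto
qed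

end

end

theory Submission
  imports Defs
begin

text \<open>A central derivation is the same as a linear map from the quotient of $A$ by the span $S$ of
  all products into the center $C$, so $\dim CD(A) = (\dim A - \dim S) \cdot \dim C$. If the product
  is nonzero, then $\dim S \geq 1$ and $\dim C < \dim A$, which gives the bounds in dimensions three
  and four. In dimension two, $S \subseteq C$ holds as well, hence both spaces are lines: if all
  squares vanish, the product is alternating and the Zinbiel identity kills all triple products;
  otherwise some $e$ and $e \bullet e$ form a basis, and the Zinbiel identity forces
  $e \bullet e$ to be central.\<close>

section \<open>Linear maps that kill one subspace and land in another\<close>

text \<open>Matrix units form a basis: extend a basis \<open>BS\<close> of \<open>S\<close> to a
  basis \<open>B\<close> of the domain, take a basis \<open>BT\<close> of \<open>T\<close>, and
  count the pairs in \<open>(B - BS) \<times> BT\<close>.\<close>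

lemma (in vector_space_pair) dim_linear_maps_vanishing_into:
  assumes fin: "finite B0" "vs1.span B0 = UNIV"
    and finT: "finite C0" "T \<subseteq> vs2.span C0"
    and S: "vs1.subspace S" and T: "vs2.subspace T"
  shows "vector_space.dim (\<lambda>c \<phi> x. s2 c (\<phi> x))
           {\<phi>. Vector_Spaces.linear s1 s2 \<phi> \<and> range \<phi> \<subseteq> T \<and> \<phi> ` S \<subseteq> {0}}
         = (vs1.dim UNIV - vs1.dim S) * vs2.dim T"
    (is "vector_space.dim ?fs ?L = _")
proof -
  interpret M: vector_space ?fs
    by unfold_locales (simp_all add: fun_eq_iff vs2.scale_right_distrib vs2.scale_left_distrib)
  obtain BS where BS: "BS \<subseteq> S" "vs1.independent BS" "S \<subseteq> vs1.span BS" "card BS = vs1.dim S"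
    by (rule vs1.basis_exists)
  obtain B where B: "BS \<subseteq> B" "vs1.independent B" "vs1.span B = UNIV"
    using vs1.maximal_independent_subset_extend[OF subset_UNIV BS(2)] by (metis top.extremum_uniqueI)
  obtain BT where BT: "BT \<subseteq> T" "vs2.independent BT" "T \<subseteq> vs2.span BT" "card BT = vs2.dim T"
    by (rule vs2.basis_exists)
  have finB: "finite B"
    using vs1.independent_span_bound[OF fin(1) B(2)] fin(2) by auto
  have finBT: "finite BT"
    using vs2.independent_span_bound[OF finT(1) BT(2)] BT(1) finT(2) by blast
  have cardB: "card B = vs1.dim UNIV"
    using vs1.dim_eq_card[of B UNIV] B(2,3) by simp
  have span_BT: "vs2.span BT = T"
    using BT(1,3) T vs2.span_minimal by blast
  \<comment> \<open>The matrix unit of \<open>(b, t)\<close>: it sends \<open>b\<close> to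
    \<open>t\<close> and every other vector of \<open>B\<close> to 0.\<close>
  define E where "E = (\<lambda>(b, t). construct B (\<lambda>x. if x = b then t else 0))"
  define I where "I = (B - BS) \<times> BT"
  have finI: "finite I" by (simp add: I_def finB finBT)
  have lin_E: "Vector_Spaces.linear s1 s2 (E p)" for p
    unfolding E_def by (cases p) (simp add: linear_construct B)
  have E_basis: "E (b, t) x = (if x = b then t else 0)" if "x \<in> B" for b t x
    unfolding E_def using that B(2) by (simp add: construct_basis)
  have eval_sum: "(\<Sum>p\<in>I. ?fs (u p) (E p)) b = (\<Sum>t\<in>BT. s2 (u (b, t)) t)" if "b \<in> B - BS" for u b
  proof -
    have "(\<Sum>p\<in>I. ?fs (u p) (E p)) b = (\<Sum>p\<in>I. s2 (u p) (E p b))"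
      using finI by (induction I rule: finite_induct) auto
    also have "\<dots> = (\<Sum>b'\<in>B - BS. \<Sum>t\<in>BT. s2 (u (b', t)) (E (b', t) b))"
      unfolding I_def by (simp add: sum.cartesian_product split_def)
    also have "\<dots> = (\<Sum>b'\<in>B - BS. if b' = b then \<Sum>t\<in>BT. s2 (u (b, t)) t else 0)"
      using that by (intro sum.cong) (auto simp: E_basis intro!: sum.neutral)
    also have "\<dots> = (\<Sum>t\<in>BT. s2 (u (b, t)) t)"
      using that finB by simp
    finally show ?thesis .
  qed
  have eval_sum_BS: "(\<Sum>p\<in>I. ?fs (u p) (E p)) b = 0" if "b \<in> BS" for u b
  proof -
    have "(\<Sum>p\<in>I. ?fs (u p) (E p)) b = (\<Sum>p\<in>I. s2 (u p) (E p b))"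
      using finI by (induction I rule: finite_induct) auto
    also have "\<dots> = 0"
      using that subsetD[OF B(1) that] by (intro sum.neutral) (auto simp: I_def E_basis)
    finally show ?thesis .
  qed
  have lin_sum: "Vector_Spaces.linear s1 s2 (\<Sum>p\<in>I. ?fs (u p) (E p))" for u
    using finI
    by (induction I rule: finite_induct)
      (auto simp: zero_fun_def plus_fun_def
        intro!: linear_zero linear_compose_add linear_compose_scale_right lin_E)
  have inj: "inj_on E I"
  proof (rule inj_onI, clarify)
    fix b t b' t' assume *: "(b, t) \<in> I" "(b', t') \<in> I" "E (b, t) = E (b', t')"
    then have "t = (if b = b' then t' else 0)"
      using E_basis[of b b t] E_basis[of b b' t'] by (auto simp: I_def)
    \<comment> \<open>An independent set does not contain 0. So \<open>E (b, t)\<close> is nonzero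
      at \<open>b\<close>, which rules out \<open>b \<noteq> b'\<close>.\<close>
    moreover have "t \<noteq> 0"
      using * BT(2) vs2.dependent_zero by (auto simp: I_def)
    ultimately show "b = b' \<and> t = t'" by (auto split: if_splits)
  qed
  have indep: "M.independent (E ` I)"
  proof (rule M.independent_if_scalars_zero)
    show "finite (E ` I)" using finI by simp
    fix f x assume *: "(\<Sum>x\<in>E ` I. ?fs (f x) x) = 0" "x \<in> E ` I"
    then obtain b t where bt: "(b, t) \<in> I" "x = E (b, t)" by auto
    have "(\<Sum>p\<in>I. ?fs (f (E p)) (E p)) = 0"
      using *(1) by (simp add: sum.reindex[OF inj])
    \<comment> \<open>Evaluation at \<open>b\<close> keeps only the matrix units with first index
      \<open>b\<close>, which turns the relation between maps into one between the vectors of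
      \<open>BT\<close>.\<close>
    then have "(\<Sum>t\<in>BT. s2 (f (E (b, t))) t) = 0"
      using eval_sum[of b "\<lambda>p. f (E p)"] bt(1) by (auto simp: I_def)
    then show "f x = 0"
      using vs2.independentD[OF BT(2) finBT subset_refl, of "\<lambda>t. f (E (b, t))" t] bt
      by (auto simp: I_def)
  qed
  have E_in: "E ` I \<subseteq> ?L"
  proof (clarify, intro conjI)
    fix b t assume bt: "(b, t) \<in> I"
    interpret l: Vector_Spaces.linear s1 s2 "E (b, t)" by (rule lin_E)
    show "Vector_Spaces.linear s1 s2 (E (b, t))" by (rule lin_E)
    have "E (b, t) ` B \<subseteq> T"
      using bt BT(1) vs2.subspace_0[OF T] by (auto simp: E_basis I_def)
    then have "vs2.span (E (b, t) ` B) \<subseteq> T"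
      by (rule vs2.span_minimal[OF _ T])
    then show "range (E (b, t)) \<subseteq> T"
      using l.span_image[of B] B(3) by simp
    have "E (b, t) ` BS \<subseteq> {0}"
      using bt B(1) by (auto simp: E_basis I_def)
    then have "vs2.span (E (b, t) ` BS) \<subseteq> {0}"
      by (rule vs2.span_minimal) simp
    then show "E (b, t) ` S \<subseteq> {0}"
      using l.span_image[of BS] BS(3) by blast
  qed
  have "?L \<subseteq> M.span (E ` I)"
  proof
    fix \<phi> assume \<phi>: "\<phi> \<in> ?L"
    \<comment> \<open>The matrix entries of \<open>\<phi>\<close>. Rows for \<open>BS\<close> are
      absent from \<open>I\<close>, as \<open>\<phi>\<close> vanishes there.\<close>
    define u where "u = (\<lambda>(b, t). vs2.representation BT (\<phi> b) t)"
    have "\<phi> b = (\<Sum>p\<in>I. ?fs (u p) (E p)) b" if "b \<in> B" for b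
    proof (cases "b \<in> BS")
      case True
      then have "\<phi> b = 0" using \<phi> BS(1) by blast
      then show ?thesis using eval_sum_BS[OF True] by simp
    next
      case False
      moreover have "\<phi> b \<in> vs2.span BT" using \<phi> span_BT by auto
      ultimately show ?thesis
        using that eval_sum[of b u] vs2.sum_representation_eq[OF BT(2) _ finBT subset_refl, of "\<phi> b"]
        by (auto simp: u_def)
    qed
    then have "\<phi> x = (\<Sum>p\<in>I. ?fs (u p) (E p)) x" for x
      using linear_eq_on[of \<phi> "\<Sum>p\<in>I. ?fs (u p) (E p)" x B] \<phi> lin_sum B(3) by blast
    then have "\<phi> = (\<Sum>p\<in>I. ?fs (u p) (E p))" by blast
    also have "\<dots> \<in> M.span (E ` I)"
      by (intro M.span_sum M.span_scale M.span_base) auto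
    finally show "\<phi> \<in> M.span (E ` I)" .
  qed
  then have "M.dim ?L = card (E ` I)"
    using M.basis_card_eq_dim[OF E_in _ indep] by simp
  also have "\<dots> = (card B - card BS) * card BT"
    using card_image[OF inj] card_Diff_subset[OF finite_subset[OF B(1) finB] B(1)]
    by (simp add: I_def card_cartesian_product)
  finally show ?thesis by (simp add: cardB BS(4) BT(4))
qed

section \<open>Finite bases from a nonzero dimension\<close>

text \<open>An infinite basis has \<open>card\<close> equal to 0, so a nonzero \<open>dim\<close>
  certifies finite dimension. This is how the later lemmas express finiteness.\<close>

lemma (in vector_space) finite_spanning_set:
  assumes "dim UNIV \<noteq> 0"
  obtains B where "finite B" "independent B" "span B = UNIV" "card B = dim UNIV"
proof -
  obtain B where B: "independent B" "UNIV \<subseteq> span B" "card B = dim UNIV"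
    using basis_exists[of UNIV] by metis
  moreover have "finite B" using B(3) assms by (intro card_ge_0_finite) simp
  ultimately show ?thesis using that by blast
qed

lemma (in vector_space) dim_psubset_UNIV:
  assumes "dim UNIV \<noteq> 0" "subspace S" "S \<noteq> UNIV"
  shows "dim S < dim UNIV"
proof -
  obtain B where "finite B" "independent B" "span B = UNIV"
    using finite_spanning_set[OF assms(1)] by metis
  then interpret finite_dimensional_vector_space scale B
    by unfold_locales
  show ?thesis
    using dim_psubset[of S UNIV] assms by (metis psubsetI span_UNIV span_eq_iff subset_UNIV)
qed

section \<open>Center and square of a Zinbiel algebra\<close>

context zinbiel_algebra
begin

lemma mult_add [simp]: "a \<bullet> (x + y) = a \<bullet> x + a \<bullet> y" "(x + y) \<bullet> a = x \<bullet> a + y \<bullet> a"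
  using linear_right[of a] linear_left[of a]
  by (auto dest: module_hom.add simp: linear_iff_module_hom)

lemma mult_scale [simp]: "a \<bullet> scale r x = scale r (a \<bullet> x)" "scale r x \<bullet> a = scale r (x \<bullet> a)"
  using linear_right[of a] linear_left[of a]
  by (auto dest: module_hom.scale simp: linear_iff_module_hom)

lemma mult_zero [simp]: "a \<bullet> 0 = 0" "0 \<bullet> a = 0"
  using mult_add(1)[of a 0 0] mult_add(2)[of 0 0 a] by simp_all

lemma subspace_center: "subspace center"
  unfolding subspace_def center_def by simp

lemma subspace_square: "subspace square"
  unfolding square_def by (rule subspace_span)

lemma mult_in_square: "a \<bullet> b \<in> square"
  unfolding square_def by (rule span_base) blast

lemma dim_CD_eq:
  assumes "dim UNIV \<noteq> 0"
  shows "dim_CD = (dim UNIV - dim square) * dim center"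
proof -
  interpret P: vector_space_pair scale scale by unfold_locales
  obtain B where "finite B" "span B = UNIV"
    using finite_spanning_set[OF assms] by metis
  moreover have "fun_scale = (\<lambda>c \<phi> x. scale c (\<phi> x))"
    by (simp add: fun_scale_def fun_eq_iff)
  ultimately show ?thesis
    unfolding dim_CD_def central_derivations_def
    using P.dim_linear_maps_vanishing_into[of B B center square] subspace_center subspace_square
    by simp
qed

text \<open>A nonzero product \<open>a \<bullet> b\<close> keeps \<open>a\<close> out of the center,
  which is therefore a proper subspace.\<close>

lemma dim_center_less:
  assumes "dim UNIV \<noteq> 0" "a \<bullet> b \<noteq> 0"
  shows "dim center < dim UNIV"
  using assms by (intro dim_psubset_UNIV subspace_center) (auto simp: center_def)

lemma dim_square_pos:
  assumes "dim UNIV \<noteq> 0" "a \<bullet> b \<noteq> 0"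
  shows "0 < dim square"
proof -
  obtain B where "finite B" "independent B" "span B = UNIV"
    using finite_spanning_set[OF assms(1)] by metis
  then interpret finite_dimensional_vector_space scale B
    by unfold_locales
  show ?thesis
    using mult_in_square[of a b] assms(2) by (metis dim_eq_0 gr0I singletonD subsetD)
qed

text \<open>Polarizing at \<open>a + b\<close> gives anticommutativity, so
  \<open>b \<bullet> c + c \<bullet> b\<close>, the factor next to \<open>a\<close> on the right of
  the Zinbiel identity, vanishes. A second use of anticommutativity moves the product to the other
  side.\<close>

lemma alternating_square_subset_center:
  assumes alt: "\<And>x. x \<bullet> x = 0"
  shows "square \<subseteq> center"
proof -
  have anti: "a \<bullet> b = - (b \<bullet> a)" for a b
  proof -
    have "a \<bullet> (a + b) + b \<bullet> (a + b) = 0"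
      using alt[of "a + b"] by (simp only: mult_add(2))
    then show ?thesis by (simp add: alt eq_neg_iff_add_eq_0)
  qed
  have left: "(a \<bullet> b) \<bullet> c = 0" for a b c
  proof -
    have "(a \<bullet> b) \<bullet> c = a \<bullet> (b \<bullet> c + c \<bullet> b)"
      by (simp add: zinbiel)
    also have "b \<bullet> c + c \<bullet> b = 0" using anti[of b c] by simp
    finally show ?thesis by simp
  qed
  have right: "c \<bullet> (a \<bullet> b) = 0" for a b c
    using anti[of c "a \<bullet> b"] by (simp add: left)
  show ?thesis
    unfolding square_def using left right
    by (intro span_minimal subspace_center) (auto simp: center_def)
qed

end

section \<open>Products in dimension two\<close>

lemma (in vector_space) independent_pair_coeffs:
  assumes "independent {e, f}" "e \<noteq> f" "scale a e + scale b f = scale a' e + scale b' f"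
  shows "a = a' \<and> b = b'"
proof -
  have "(\<Sum>x\<in>{e, f}. scale (if x = e then a - a' else b - b') x) = 0"
    using assms(2,3) by (simp add: scale_left_diff_distrib algebra_simps)
  then have "\<forall>x\<in>{e, f}. (if x = e then a - a' else b - b') = 0"
    using independentD[OF assms(1) _ subset_refl, of "\<lambda>x. if x = e then a - a' else b - b'"]
    by simp
  then show ?thesis using assms(2) by auto
qed

text \<open>The Zinbiel identity at \<open>e, e, e\<close> reads c^2 e = 2 c^2 e, so c or e is
  0.\<close>

lemma (in zinbiel_algebra) mult_self_eq_scale_imp_zero:
  assumes "e \<bullet> e = scale c e"
  shows "e \<bullet> e = 0"
proof -
  have "scale (c * c) e = scale (c * c) e + scale (c * c) e"
    using zinbiel[of e e e] assms by simp
  then have "scale (c * c) e = 0" by simp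
  then show ?thesis using assms by auto
qed

text \<open>In the non-alternating case all products turn out to be multiples of the central element
  \<open>e \<bullet> e\<close>. The hypothesis \<open>char\<close> serves to divide by 2 when
  solving for the structure constants.\<close>

lemma (in zinbiel_algebra) square_subset_center_of_dim_2:
  assumes dim2: "dim UNIV = 2" and char: "(2 :: 'k) \<noteq> 0"
  shows "square \<subseteq> center"
proof (cases "\<forall>x. x \<bullet> x = 0")
  case True
  then show ?thesis by (intro alternating_square_subset_center) simp
next
  case False
  then obtain e where e: "e \<bullet> e \<noteq> 0" by auto
  define f where "f = e \<bullet> e"
  have f_not: "f \<notin> span {e}"
    using mult_self_eq_scale_imp_zero e by (auto simp: f_def span_singleton)
  then have ef: "e \<noteq> f" using span_base[of e "{e}"] by auto
  have "e \<noteq> 0" using e by auto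
  then have "independent {f, e}"
    using f_not by (simp add: independent_insert)
  then have ind: "independent {e, f}" by (simp add: insert_commute)
  have span_ef: "span {e, f} = UNIV"
  proof (rule ccontr)
    assume "span {e, f} \<noteq> UNIV"
    then have "dim (span {e, f}) < dim UNIV"
      using dim2 by (intro dim_psubset_UNIV) auto
    then show False
      using dim_eq_card_independent[OF ind] dim2 ef by simp
  qed
  have decomp: "\<exists>\<alpha> \<beta>. x = scale \<alpha> e + scale \<beta> f" for x
  proof -
    have "x \<in> span {e, f}" using span_ef by simp
    then obtain \<alpha> \<beta> where "x - scale \<alpha> e = scale \<beta> f"
      using span_breakdown_eq[of x e "{f}"] by (auto simp: span_singleton)
    then have "x = scale \<alpha> e + scale \<beta> f" by (simp add: diff_eq_eq add.commute)
    then show ?thesis by blast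
  qed
  \<comment> \<open>These two constants are the only unknowns: the Zinbiel identity expresses
    \<open>f \<bullet> e\<close> and \<open>f \<bullet> f\<close> through
    \<open>e \<bullet> f\<close>.\<close>
  obtain \<alpha> \<beta> where e_f: "e \<bullet> f = scale \<alpha> e + scale \<beta> f"
    using decomp by blast
  have f_e: "f \<bullet> e = e \<bullet> f + e \<bullet> f"
    using zinbiel[of e e e] by (simp add: f_def)
  have f_e': "f \<bullet> e = scale (\<alpha> + \<alpha>) e + scale (\<beta> + \<beta>) f"
    by (simp only: f_e e_f scale_left_distrib add_ac)
  have e_ef: "e \<bullet> (e \<bullet> f) = scale (\<alpha> * \<beta>) e + scale (\<alpha> + \<beta> * \<beta>) f"
    by (simp add: e_f scale_left_distrib scale_right_distrib add_ac mult_ac flip: f_def)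
  \<comment> \<open>The product is computed twice, by the Zinbiel identity at \<open>e, f, e\<close>
    and by expanding \<open>e \<bullet> f\<close>; comparing coordinates constrains \<alpha> and
    \<beta>.\<close>
  have "(e \<bullet> f) \<bullet> e = e \<bullet> (e \<bullet> f) + e \<bullet> (e \<bullet> f) + e \<bullet> (e \<bullet> f)"
    unfolding zinbiel[of e f e] f_e mult_add ..
  moreover have "(e \<bullet> f) \<bullet> e = scale \<alpha> f + scale \<beta> (f \<bullet> e)"
    by (simp add: e_f flip: f_def)
  ultimately have "scale (\<beta> * (\<alpha> + \<alpha>)) e + scale (\<alpha> + \<beta> * (\<beta> + \<beta>)) f
      = scale (\<alpha> * \<beta> + \<alpha> * \<beta> + \<alpha> * \<beta>) e
        + scale (\<alpha> + \<beta> * \<beta> + (\<alpha> + \<beta> * \<beta>) + (\<alpha> + \<beta> * \<beta>)) f"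
    unfolding f_e' e_ef
    by (simp only: scale_left_distrib scale_right_distrib scale_scale distrib_left mult_ac add_ac)
  then have eqs: "\<beta> * (\<alpha> + \<alpha>) = \<alpha> * \<beta> + \<alpha> * \<beta> + \<alpha> * \<beta>"
      "\<alpha> + \<beta> * (\<beta> + \<beta>) = \<alpha> + \<beta> * \<beta> + (\<alpha> + \<beta> * \<beta>) + (\<alpha> + \<beta> * \<beta>)"
    using independent_pair_coeffs[OF ind ef] by blast+
  have "\<alpha> * \<beta> = 0" using eqs(1) by algebra
  moreover have "\<beta> * \<beta> + 2 * \<alpha> = 0" using eqs(2) by algebra
  \<comment> \<open>If \<alpha> = 0, the second equation gives \<beta>^2 = 0; if \<beta> = 0, it
    gives 2 \<alpha> = 0.\<close>
  ultimately have zero: "\<alpha> = 0" "\<beta> = 0" using char by auto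
  have prods: "e \<bullet> f = 0" "f \<bullet> e = 0"
    using f_e by (simp_all add: e_f zero)
  have f_f: "f \<bullet> f = 0"
    using zinbiel[of e e f] by (simp add: prods flip: f_def)
  have "f \<in> center"
    unfolding center_def
  proof (clarify, intro conjI)
    fix x
    obtain a b where "x = scale a e + scale b f" using decomp by blast
    then show "f \<bullet> x = 0" "x \<bullet> f = 0" by (simp_all add: prods f_f)
  qed
  moreover have "\<exists>c. x \<bullet> y = scale c f" for x y
  proof -
    obtain a b a' b' where "x = scale a e + scale b f" "y = scale a' e + scale b' f"
      using decomp by metis
    then have "x \<bullet> y = scale (a * a') f" by (simp add: prods f_f mult.commute flip: f_def)
    then show ?thesis by blast
  qed
  ultimately have "x \<bullet> y \<in> center" for x y
    using subspace_scale[OF subspace_center] by metis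
  then show ?thesis
    unfolding square_def by (intro span_minimal subspace_center) blast
qed

text \<open>The zero product is excluded in dimensions two and four, where it would give 4 and 16.
  In dimension three it gives 9, which meets the bound.\<close>

theorem corollary3p7:
  fixes scale :: "complex \<Rightarrow> 'a::ab_group_add \<Rightarrow> 'a"
    and zmult :: "'a \<Rightarrow> 'a \<Rightarrow> 'a"
  assumes "zinbiel_algebra scale zmult"
  shows "(vector_space.dim scale (UNIV :: 'a set) = 2 \<and> (\<exists>a b. zmult a b \<noteq> 0) \<longrightarrow>
           zinbiel_algebra.dim_CD scale zmult = 1)
       \<and> (vector_space.dim scale (UNIV :: 'a set) = 3 \<longrightarrow>
           0 \<le> zinbiel_algebra.dim_CD scale zmult \<and> zinbiel_algebra.dim_CD scale zmult \<le> 9)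
       \<and> (vector_space.dim scale (UNIV :: 'a set) = 4 \<and> (\<exists>a b. zmult a b \<noteq> 0) \<longrightarrow>
           0 \<le> zinbiel_algebra.dim_CD scale zmult \<and> zinbiel_algebra.dim_CD scale zmult \<le> 9)"
proof -
  interpret zinbiel_algebra scale zmult by fact
  show ?thesis
  proof (intro conjI impI)
    assume "dim UNIV = 2 \<and> (\<exists>a b. zmult a b \<noteq> 0)"
    then obtain a b where dim2: "dim UNIV = 2" and ab: "zmult a b \<noteq> 0" by blast
    obtain B where "finite B" "independent B" "span B = UNIV"
      using finite_spanning_set dim2 by (metis zero_neq_numeral)
    then interpret finite_dimensional_vector_space scale B by unfold_locales
    have "dim square \<le> dim center"
      using square_subset_center_of_dim_2[OF dim2] by (intro dim_subset) simp
    moreover have "dim center < 2" "0 < dim square"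
      using dim_center_less[OF _ ab] dim_square_pos[OF _ ab] dim2 by simp_all
    \<comment> \<open>The chain 0 < \<open>dim square\<close> \<le> \<open>dim center\<close> < 2
      leaves one value for both.\<close>
    ultimately have "dim center = 1" "dim square = 1" by simp_all
    then show "dim_CD = 1" using dim_CD_eq dim2 by simp
  next
    assume dim3: "dim UNIV = 3"
    \<comment> \<open>The center may be the whole space here, and \<open>dim_psubset_UNIV\<close>
      covers only proper subspaces; hence the case split.\<close>
    have "dim center \<le> 3"
      using dim_psubset_UNIV[OF _ subspace_center] dim3 by (cases "center = UNIV") auto
    then have "(3 - dim square) * dim center \<le> 3 * 3"
      by (intro mult_le_mono) auto
    then show "dim_CD \<le> 9" using dim_CD_eq dim3 by simp
  next
    assume "dim UNIV = 4 \<and> (\<exists>a b. zmult a b \<noteq> 0)"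
    then obtain a b where dim4: "dim UNIV = 4" and ab: "zmult a b \<noteq> 0" by blast
    have "dim center < 4" "0 < dim square"
      using dim_center_less[OF _ ab] dim_square_pos[OF _ ab] dim4 by simp_all
    \<comment> \<open>A nonzero product lowers each factor from at most 4 to at most 3.\<close>
    then have "(4 - dim square) * dim center \<le> 3 * 3"
      by (intro mult_le_mono) auto
    then show "dim_CD \<le> 9" using dim_CD_eq dim4 by simp
  qed simp_all
qed

end
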